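(* Let $a=(a_n)_{n\ge1}$ be an integer sequence with the property that for every prime $\ell$ there exist a positive integer $n_\ell$, rational numbers $c_{\ell,0},\dots,c_{\ell,n_\ell-1}$, and non-negative integers $e_{\ell,0},\dots,e_{\ell,n_\ell-1}$ such that $|a_n|_\ell=c_{\ell,k}|n|_\ell^{e_{\ell,k}}$ whenever $n\equiv k\bmod n_\ell$ (with $k\in\{0,\dots,n_\ell-1\}$). Let $S$ be a finite set of primes and write $f(z)=\sum_{n\ge1}|a_n|_S z^n$. If the sequence $(|a_n|_S)_{n\ge1}$ takes infinitely many values, then $f$ admits the unit circle as a natural boundary. Otherwise, $f$ is a rational function.
   Context: For a prime $\ell$, $|\cdot|_\ell$ is the $\ell$-adic absolute value on $\mathbf{Q}$ normalised by $|\ell|_\ell=1/\ell$ (and $|0|_\ell=0$). For a set $S$ of primes and $m\in\mathbf{Q}$, $|m|_S=\prod_{\ell\in S}|m|_\ell$. The unit circle is a natural boundary of $f$ if $f$ is analytic in the open unit disc and does not extend analytically across any point of the unit circle. *)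

theory Defs
  imports "HOL-Complex_Analysis.Complex_Analysis" "HOL-Number_Theory.Cong"
begin

definition ladic_abs :: "nat \<Rightarrow> rat \<Rightarrow> rat" where
  "ladic_abs l x = (if x = 0 then 0 else
     of_nat l powi (int (multiplicity (int l) (snd (quotient_of x)))
                    - int (multiplicity (int l) (fst (quotient_of x)))))"

definition S_abs :: "nat set \<Rightarrow> rat \<Rightarrow> rat" where
  "S_abs S m = (\<Prod>l\<in>S. ladic_abs l m)"

(* The value at index 0 of the sequence is never used. *)
definition S_abs_series :: "nat set \<Rightarrow> (nat \<Rightarrow> int) \<Rightarrow> complex \<Rightarrow> complex" where
  "S_abs_series S a z = (\<Sum>n. of_rat (S_abs S (of_int (a (Suc n)))) * z ^ Suc n)"

(* Only the values of f on the open unit disc matter in the next two definitions. *)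
definition unit_circle_natural_boundary :: "(complex \<Rightarrow> complex) \<Rightarrow> bool" where
  "unit_circle_natural_boundary f \<longleftrightarrow>
     f analytic_on ball 0 1 \<and>
     (\<forall>w\<in>sphere 0 1. \<not> (\<exists>U g. open U \<and> w \<in> U \<and> g analytic_on U \<and>
        (\<forall>z\<in>U \<inter> ball 0 1. g z = f z)))"

definition rational_on_unit_disc :: "(complex \<Rightarrow> complex) \<Rightarrow> bool" where
  "rational_on_unit_disc f \<longleftrightarrow>
     (\<exists>p q :: complex poly. q \<noteq> 0 \<and>
        (\<forall>z\<in>ball 0 1. poly q z \<noteq> 0 \<and> f z = poly p z / poly q z))"

end

theory Submission imports Defs begin

text \<open>
  Combining the hypotheses for the finitely many primes of \<open>S\<close> gives
  \<open>|a n|_S = C n * (\<Prod>l\<in>S. |n|_l ^ E l n)\<close> with \<open>C \<ge> 0\<close> and \<open>C\<close>, \<open>E\<close> periodic modulo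
  some \<open>N\<close>. Such a sequence \<open>b\<close> is a uniform limit of periodic sequences: replace \<open>|n|_l\<close> by
  its truncation \<open>1 / gcd n (l ^ m)\<close>.

  Suppose that for some \<open>j\<close> no positive \<open>n\<close> with \<open>C n > 0\<close> is divisible by \<open>l ^ j\<close> for an \<open>l \<in> S\<close> with
  \<open>E l n > 0\<close>. Then truncating at \<open>l ^ j\<close> changes nothing, so \<open>b\<close> is periodic
  (\<open>periodic_values\<close>), takes finitely many values and has a rational generating function.
  Otherwise \<open>b\<close> takes arbitrarily small positive values (\<open>finite_values_iff\<close>), and the circle has
  to be a natural boundary.

  In the latter case the singularities are visible at roots of unity \<open>\<zeta>\<close> of exact order
  \<open>l ^ j\<close>, and these are as dense as desired for large \<open>j\<close>
  (\<open>primitive_prime_power_root_near\<close>). Let \<open>\<beta>\<close> be \<open>b\<close> with only the \<open>l\<close>-part truncated,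
  at \<open>l ^ (j - 1)\<close>. It is a uniform limit of sequences with periods not divisible by
  \<open>l ^ j\<close>, whose series have no pole at \<open>\<zeta>\<close>; so the series of \<open>\<beta>\<close> is
  \<open>o (1 / (1 - r))\<close> at \<open>r * \<zeta>\<close> as \<open>r\<close> tends to 1 (\<open>radial_limit_limit_periodic\<close>).
  The difference \<open>\<beta> - b\<close> is nonnegative and lives on the multiples of \<open>l ^ j\<close>, where
  \<open>\<zeta> ^ n = 1\<close>; there is no cancellation, and since it is a positive constant along an arithmetic
  progression its series is at least a constant times \<open>1 / (1 - r)\<close>
  (\<open>radial_lower_bound\<close>). Hence the series of \<open>b\<close> is not \<open>o (1 / (1 - r))\<close> along the radius
  to \<open>\<zeta>\<close> (\<open>radial_growth\<close>), which is impossible if it continues analytically across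
  \<open>\<zeta>\<close> (\<open>radial_limit_regular_point\<close>). Working with \<open>\<beta>\<close> avoids computing any Fourier
  coefficient of \<open>b\<close>.
\<close>

section \<open>Growth of power series along radii\<close>

text \<open>The coefficient of index 0 is left out: the sequences below satisfy their defining
  relations only at positive indices.\<close>

definition gen_series :: "(nat \<Rightarrow> complex) \<Rightarrow> complex \<Rightarrow> complex" where
  "gen_series u z = (\<Sum>n. u (Suc n) * z ^ Suc n)"

lemma geometric_majorant_sums:
  fixes z :: complex
  assumes "norm z < 1"
  shows "(\<lambda>n. B * norm z ^ Suc n) sums (B * (norm z / (1 - norm z)))"
proof -
  have "(\<lambda>n. norm z ^ n) sums (1 / (1 - norm z))"
    using assms by (intro geometric_sums) auto
  from sums_mult[OF this, of "B * norm z"] show ?thesis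
    by (simp add: mult_ac)
qed

lemma
  assumes u: "\<And>n. 0 < n \<Longrightarrow> norm (u n) \<le> B" and z: "norm z < 1"
  shows summable_gen_series: "summable (\<lambda>n. u (Suc n) * z ^ Suc n)"
    and norm_gen_series_le: "norm (gen_series u z) \<le> B * (norm z / (1 - norm z))"
proof -
  have le: "norm (u (Suc n) * z ^ Suc n) \<le> B * norm z ^ Suc n" for n
    unfolding norm_mult norm_power by (intro mult_right_mono u) auto
  note sums = geometric_majorant_sums[OF z, of B]
  have sn: "summable (\<lambda>n. norm (u (Suc n) * z ^ Suc n))"
    by (rule summable_comparison_test'[OF sums_summable[OF sums], of 0]) (use le in auto)
  then show "summable (\<lambda>n. u (Suc n) * z ^ Suc n)"
    by (rule summable_norm_cancel)
  have "norm (gen_series u z) \<le> (\<Sum>n. norm (u (Suc n) * z ^ Suc n))"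
    unfolding gen_series_def by (rule summable_norm[OF sn])
  also have "\<dots> \<le> (\<Sum>n. B * norm z ^ Suc n)"
    by (rule suminf_le[OF le sn sums_summable[OF sums]])
  also have "\<dots> = B * (norm z / (1 - norm z))"
    using sums by (simp add: sums_iff)
  finally show "norm (gen_series u z) \<le> B * (norm z / (1 - norm z))" .
qed

lemma gen_series_add:
  assumes "\<And>n. 0 < n \<Longrightarrow> norm (u n) \<le> B" "\<And>n. 0 < n \<Longrightarrow> norm (v n) \<le> B'" "norm z < 1"
  shows "gen_series (\<lambda>n. u n + v n) z = gen_series u z + gen_series v z"
  unfolding gen_series_def ring_distribs
  by (intro suminf_add[symmetric] summable_gen_series[OF assms(1,3)]
        summable_gen_series[OF assms(2,3)])

lemma gen_series_analytic:
  assumes "\<And>n. 0 < n \<Longrightarrow> norm (u n) \<le> B"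
  shows "gen_series u analytic_on ball 0 1"
proof -
  have "(\<lambda>n. (if n = 0 then 0 else u n) * (z - 0) ^ n) sums gen_series u z" if "z \<in> ball 0 1" for z
  proof -
    have "(\<lambda>n. u (Suc n) * z ^ Suc n) sums gen_series u z"
      unfolding gen_series_def
      by (rule summable_sums[OF summable_gen_series[OF assms]]) (use that in auto)
    then have "(\<lambda>n. (\<lambda>n. (if n = 0 then 0 else u n) * z ^ n) (Suc n)) sums gen_series u z"
      by simp
    then show ?thesis by (subst (asm) sums_Suc_iff) simp
  qed
  then have "gen_series u holomorphic_on ball 0 1"
    by (rule power_series_holomorphic)
  then show ?thesis by (simp add: analytic_on_open)
qed

lemma gen_series_periodic:
  assumes q: "\<And>n. 0 < n \<Longrightarrow> norm (q n) \<le> B" and per: "\<And>n. q (n + T) = q n" and z: "norm z < 1"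
  shows "gen_series q z * (1 - z ^ T) = (\<Sum>n<T. q (Suc n) * z ^ Suc n)"
proof -
  let ?h = "\<lambda>n. q (Suc n) * z ^ Suc n"
  have s: "summable ?h" by (rule summable_gen_series[OF q z])
  have "?h (n + T) = ?h n * z ^ T" for n
    using per[of "Suc n"] by (simp add: power_add algebra_simps)
  then have "(\<Sum>n. ?h (n + T)) = (\<Sum>n. ?h n) * z ^ T"
    by (simp only: suminf_mult2[OF s])
  with suminf_split_initial_segment[OF s, of T] show ?thesis
    unfolding gen_series_def by (simp add: algebra_simps)
qed

text \<open>Grouping a periodic series by residues gives a geometric series in \<open>z ^ T\<close>, so the
  denominator is \<open>1 - z ^ T\<close>.\<close>

lemma gen_series_periodic_rational:
  assumes q: "\<And>n. 0 < n \<Longrightarrow> norm (q n) \<le> B" and per: "\<And>n. q (n + T) = q n" and T: "0 < T"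
  shows "rational_on_unit_disc (gen_series q)"
proof -
  define P where "P = (\<Sum>n<T. monom (q (Suc n)) (Suc n))"
  define Q :: "complex poly" where "Q = 1 - monom 1 T"
  have P: "poly P z = (\<Sum>n<T. q (Suc n) * z ^ Suc n)" for z
    unfolding P_def poly_sum poly_monom ..
  have Q: "poly Q z = 1 - z ^ T" for z unfolding Q_def by (simp add: poly_monom)
  have "Q \<noteq> 0" using Q[of 0] T by (auto simp: zero_power)
  moreover have "poly Q z \<noteq> 0 \<and> gen_series q z = poly P z / poly Q z" if "z \<in> ball 0 1" for z
  proof -
    have z: "norm z < 1" using that by simp
    have "z ^ T \<noteq> 1"
    proof
      assume "z ^ T = 1"
      then have "norm z ^ T = 1" by (metis norm_one norm_power)
      then show False using z T power_strict_mono[of "norm z" 1 T] by simp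
    qed
    then show ?thesis using gen_series_periodic[of q B T z, OF q per z] unfolding P Q
      by (simp add: field_simps)
  qed
  ultimately show ?thesis unfolding rational_on_unit_disc_def by blast
qed

lemma at_left_1_less: "eventually (\<lambda>r::real. 0 < r \<and> r < 1) (at_left 1)"
  using eventually_at_left_real[of 0 1] by simp

text \<open>A \<open>T\<close>-periodic series has poles only at \<open>T\<close>-th roots of unity, so it stays bounded
  along the radius to \<open>\<zeta>\<close> when \<open>\<zeta> ^ T \<noteq> 1\<close>. A coefficient error of size \<open>\<epsilon>\<close>
  contributes at most \<open>\<epsilon> / (1 - r)\<close>, which the factor \<open>1 - r\<close> absorbs; hence the
  growth rate vanishes for uniform limits of such sequences, whatever the periods \<open>T\<close>.\<close>

lemma radial_limit_limit_periodic:
  fixes \<zeta> :: complex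
  assumes u: "\<And>n. 0 < n \<Longrightarrow> norm (u n) \<le> B" and \<zeta>: "norm \<zeta> = 1"
    and approx: "\<And>\<epsilon>. 0 < \<epsilon> \<Longrightarrow> \<exists>q T. (\<forall>n>0. norm (q n) \<le> B) \<and> (\<forall>n. q (n + T) = q n) \<and>
      \<zeta> ^ T \<noteq> 1 \<and> (\<forall>n>0. norm (u n - q n) \<le> \<epsilon>)"
  shows "((\<lambda>r. of_real (1 - r) * gen_series u (of_real r * \<zeta>)) \<longlongrightarrow> 0) (at_left 1)"
proof (rule tendstoI)
  fix \<epsilon> :: real assume "0 < \<epsilon>"
  then have "0 < \<epsilon> / 2" by simp
  from approx[OF this] obtain q T where q: "\<And>n. 0 < n \<Longrightarrow> norm (q n) \<le> B"
    and per: "\<And>n. q (n + T) = q n" and T: "\<zeta> ^ T \<noteq> 1"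
    and d: "\<And>n. 0 < n \<Longrightarrow> norm (u n - q n) \<le> \<epsilon> / 2" by blast
  let ?R = "\<lambda>r. of_real (1 - r) * ((\<Sum>n<T. q (Suc n) * (of_real r * \<zeta>) ^ Suc n) / (1 - (of_real r * \<zeta>) ^ T))"
  have "(?R \<longlongrightarrow> of_real (1 - 1) * ((\<Sum>n<T. q (Suc n) * (of_real 1 * \<zeta>) ^ Suc n) / (1 - (of_real 1 * \<zeta>) ^ T)))
      (at_left 1)"
    using T by (intro tendsto_intros) auto
  then have "(?R \<longlongrightarrow> 0) (at_left 1)" by simp
  then have "eventually (\<lambda>r. norm (?R r) < \<epsilon> / 2) (at_left 1)"
    using tendstoD[OF _ \<open>0 < \<epsilon> / 2\<close>] by fastforce
  then show "eventually (\<lambda>r. dist (of_real (1 - r) * gen_series u (of_real r * \<zeta>)) 0 < \<epsilon>) (at_left 1)"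
    using at_left_1_less
  proof eventually_elim
    case (elim r)
    define z where "z = of_real r * \<zeta>"
    have nz: "norm z = r" unfolding z_def norm_mult using elim \<zeta> by simp
    have z: "norm z < 1" using nz elim by simp
    have "z ^ T \<noteq> 1"
    proof
      assume *: "z ^ T = 1"
      then have "norm z ^ T = 1" by (metis norm_one norm_power)
      moreover have "T \<noteq> 0" using T by (cases T) auto
      ultimately show False using z nz elim power_strict_mono[of "norm z" 1 T] by simp
    qed
    then have *: "gen_series q z = (\<Sum>n<T. q (Suc n) * z ^ Suc n) / (1 - z ^ T)"
      using gen_series_periodic[of q B T z, OF q per z] by (simp add: field_simps)
    have "gen_series (\<lambda>n. (u n - q n) + q n) z = gen_series (\<lambda>n. u n - q n) z + gen_series q z"
      by (rule gen_series_add[OF d q z])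
    then have "gen_series u z = gen_series (\<lambda>n. u n - q n) z + gen_series q z" by simp
    then have "of_real (1 - r) * gen_series u z = of_real (1 - r) * gen_series (\<lambda>n. u n - q n) z + ?R r"
      by (simp only: distrib_left * flip: z_def)
    then have "norm (of_real (1 - r) * gen_series u z)
        \<le> norm (of_real (1 - r) * gen_series (\<lambda>n. u n - q n) z) + norm (?R r)"
      by (simp only: norm_triangle_ineq)
    also have "norm (of_real (1 - r) * gen_series (\<lambda>n. u n - q n) z) \<le> (1 - r) * (\<epsilon> / 2 * (r / (1 - r)))"
      using norm_gen_series_le[OF d z] elim unfolding norm_mult nz
      by (intro mult_mono) (auto simp del: of_real_diff)
    also have "\<dots> = \<epsilon> / 2 * r"
    proof -
      have "1 - r \<noteq> 0" using elim by simp
      then have "(1 - r) * (r / (1 - r)) = r" by (simp only: times_divide_eq_right nonzero_mult_div_cancel_left not_False_eq_True)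
      then show ?thesis by (metis mult.left_commute)
    qed
    also have "\<dots> \<le> \<epsilon> / 2 * 1" using elim \<open>0 < \<epsilon>\<close> by (intro mult_left_mono) auto
    finally show ?case using elim(1) unfolding z_def dist_0_norm dist_commute[of _ 0] by linarith
  qed
qed

text \<open>An extension across \<open>\<zeta>\<close> is bounded near \<open>\<zeta>\<close>, so radial growth of order
  \<open>1 / (1 - r)\<close> excludes it.\<close>

lemma radial_limit_regular_point:
  assumes U: "open U" "\<zeta> \<in> U" and g: "g analytic_on U" and eq: "\<And>z. z \<in> U \<inter> ball 0 1 \<Longrightarrow> g z = f z"
    and \<zeta>: "norm \<zeta> = 1"
  shows "((\<lambda>r. of_real (1 - r) * f (of_real r * \<zeta>)) \<longlongrightarrow> 0) (at_left 1)"
proof -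
  have lim: "((\<lambda>r. of_real r * \<zeta>) \<longlongrightarrow> of_real 1 * \<zeta>) (at_left (1::real))"
    by (intro tendsto_intros)
  have "isCont g \<zeta>"
    using g U by (meson analytic_imp_holomorphic holomorphic_on_imp_continuous_on continuous_on_eq_continuous_at)
  then have "((\<lambda>r. g (of_real r * \<zeta>)) \<longlongrightarrow> g \<zeta>) (at_left (1::real))"
    using isCont_tendsto_compose lim by fastforce
  then have "((\<lambda>r. of_real (1 - r) * g (of_real r * \<zeta>)) \<longlongrightarrow> of_real (1 - 1) * g \<zeta>) (at_left 1)"
    by (intro tendsto_intros)
  then have *: "((\<lambda>r. of_real (1 - r) * g (of_real r * \<zeta>)) \<longlongrightarrow> 0) (at_left 1)" by simp
  have "eventually (\<lambda>r. of_real r * \<zeta> \<in> U) (at_left (1::real))"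
    using topological_tendstoD[OF lim U(1)] U(2) by simp
  then have "eventually (\<lambda>r. of_real (1 - r) * g (of_real r * \<zeta>) = of_real (1 - r) * f (of_real r * \<zeta>)) (at_left 1)"
    using at_left_1_less
  proof eventually_elim
    case (elim r)
    then have "of_real r * \<zeta> \<in> U \<inter> ball 0 1" using \<zeta> by (simp add: norm_mult)
    then show ?case using eq by simp
  qed
  from tendsto_cong[OF this] * show ?thesis by (rule iffD1)
qed

text \<open>If \<open>\<zeta> ^ n = 1\<close> on the support of \<open>h\<close>, the series at \<open>r * \<zeta>\<close> equals the series
  at \<open>r\<close>, which has nonnegative terms. The progression alone then contributes
  \<open>c * r ^ m / (1 - r ^ Q)\<close>, which is asymptotic to \<open>c / (Q * (1 - r))\<close>.\<close>

lemma radial_lower_bound: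
  assumes h: "\<And>n. 0 < n \<Longrightarrow> 0 \<le> h n" "\<And>n. 0 < n \<Longrightarrow> h n \<le> B"
    and zero: "\<And>n. 0 < n \<Longrightarrow> h n \<noteq> 0 \<Longrightarrow> \<zeta> ^ n = 1"
    and ap: "\<And>t. h (m + t * Q) = c" and c: "0 < c" and m: "0 < m" and Q: "0 < Q"
    and \<zeta>: "norm \<zeta> = 1"
  shows "\<not> ((\<lambda>r. of_real (1 - r) * gen_series (\<lambda>n. of_real (h n)) (of_real r * \<zeta>)) \<longlongrightarrow> 0) (at_left 1)"
proof
  assume lim: "((\<lambda>r. of_real (1 - r) * gen_series (\<lambda>n. of_real (h n)) (of_real r * \<zeta>)) \<longlongrightarrow> 0) (at_left 1)"
  have b: "norm (complex_of_real (h n)) \<le> B" if "0 < n" for n using h[OF that] by simp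
  have ev: "eventually (\<lambda>r. c * r ^ m / real Q \<le> norm (of_real (1 - r) * gen_series (\<lambda>n. of_real (h n)) (of_real r * \<zeta>)))
      (at_left 1)"
    using at_left_1_less
  proof eventually_elim
    case (elim r)
    define s where "s = (\<lambda>n. h (Suc n) * r ^ Suc n)"
    have eq: "of_real (h (Suc n)) * (of_real r * \<zeta>) ^ Suc n = complex_of_real (s n)" for n
    proof (cases "h (Suc n) = 0")
      case False
      then show ?thesis using zero[of "Suc n"] unfolding s_def power_mult_distrib by simp
    qed (simp add: s_def)
    have "summable (\<lambda>n. of_real (h (Suc n)) * (of_real r * \<zeta>) ^ Suc n)"
      by (rule summable_gen_series[where u = "\<lambda>n. of_real (h n)", OF b]) (use elim \<zeta> in \<open>simp_all add: norm_mult\<close>)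
    then have ss: "summable s" unfolding eq by simp
    have gs: "gen_series (\<lambda>n. of_real (h n)) (of_real r * \<zeta>) = of_real (suminf s)"
      unfolding gen_series_def eq using suminf_of_real[OF ss] by metis
    have s0: "0 \<le> s n" for n unfolding s_def using h(1)[of "Suc n"] elim by simp
    define k where "k = (\<lambda>t. m - 1 + t * Q)"
    have k: "Suc (k t) = m + t * Q" for t unfolding k_def using m by simp
    have sk: "s (k t) = c * r ^ m * (r ^ Q) ^ t" for t
      unfolding s_def k ap power_add by (simp add: power_mult mult.commute)
    have rQ: "0 < r ^ Q" "r ^ Q < 1" using elim Q power_strict_mono[of r 1 Q] by auto
    have "(\<lambda>t. s (k t)) sums (c * r ^ m * (1 / (1 - r ^ Q)))"
      unfolding sk using rQ by (intro sums_mult geometric_sums) auto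
    moreover have "(\<Sum>t. s (k t)) \<le> suminf s"
    proof -
      have "inj k" unfolding k_def using Q by (auto simp: inj_def)
      then show ?thesis using suminf_reindex_mono[OF ss, of k] s0 by (simp add: o_def)
    qed
    ultimately have L: "c * r ^ m * (1 / (1 - r ^ Q)) \<le> suminf s" by (simp add: sums_iff)
    \<comment> \<open>Bernoulli turns the geometric factor into a bound linear in \<open>1 - r\<close>.\<close>
    have "1 + real Q * (r - 1) \<le> (1 + (r - 1)) ^ Q"
      by (rule Bernoulli_inequality) (use elim in simp)
    then have "1 - r ^ Q \<le> real Q * (1 - r)" by (simp add: algebra_simps)
    then have "c * r ^ m * (1 - r ^ Q) \<le> c * r ^ m * (real Q * (1 - r))"
      using c elim by (intro mult_left_mono) auto
    then have "c * r ^ m / real Q \<le> (1 - r) * (c * r ^ m * (1 / (1 - r ^ Q)))"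
      using Q rQ by (simp add: field_simps)
    also have "\<dots> \<le> (1 - r) * suminf s" using L elim by (intro mult_left_mono) auto
    also have "\<dots> = norm (of_real (1 - r) * gen_series (\<lambda>n. of_real (h n)) (of_real r * \<zeta>))"
      unfolding gs norm_mult norm_of_real using elim s0 suminf_nonneg[OF ss] by simp
    finally show ?case .
  qed
  have "((\<lambda>r. c * r ^ m / real Q) \<longlongrightarrow> c * 1 ^ m / real Q) (at_left 1)"
    using Q by (intro tendsto_intros) auto
  from tendsto_le[OF _ tendsto_norm[OF lim] this ev] have "c / real Q \<le> 0" by simp
  then show False using c Q by (simp add: field_simps)
qed

section \<open>Roots of unity of prime power order\<close>

lemma norm_cis_diff_le: "norm (cis x - cis y) \<le> \<bar>x - y\<bar>"
proof -
  have "cis x - cis y = cis y * (exp (\<i> * of_real (x - y)) - 1)"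
    by (simp add: cis_conv_exp exp_diff algebra_simps)
  then have "norm (cis x - cis y) = 2 * \<bar>sin ((x - y) / 2)\<bar>"
    by (simp only: norm_mult norm_cis dist_exp_i_1 mult_1)
  also have "\<dots> \<le> \<bar>x - y\<bar>" using abs_sin_x_le_abs_x[of "(x - y) / 2"] by simp
  finally show ?thesis .
qed

text \<open>Consecutive \<open>l ^ j\<close>-th roots of unity are at angle \<open>2 * pi / l ^ j\<close>, and of two
  consecutive exponents at least one is prime to \<open>l\<close>.\<close>

lemma primitive_prime_power_root_near:
  fixes w :: complex
  assumes w: "norm w = 1" and l: "prime (l::nat)"
  obtains \<zeta> where "norm \<zeta> = 1" "norm (\<zeta> - w) \<le> 2 * pi / real (l ^ j)" "\<And>n. \<zeta> ^ n = 1 \<longleftrightarrow> l ^ j dvd n"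
proof (cases "j = 0")
  case True
  have "norm (1 - w) \<le> 2" using norm_triangle_ineq4[of 1 w] w by simp
  also have "\<dots> \<le> 2 * pi" using pi_gt3 by simp
  finally show ?thesis using that[of 1] True by simp
next
  case j: False
  define L where "L = l ^ j"
  have L: "0 < L" unfolding L_def using l by (simp add: prime_gt_0_nat)
  have wc: "w = cis (Arg2pi w)" using Arg2pi_eq[of w] w by (simp add: cis_conv_exp)
  define x where "x = Arg2pi w * real L / (2 * pi)"
  define m0 where "m0 = nat \<lfloor>x\<rfloor>"
  have x0: "0 \<le> x" unfolding x_def using Arg2pi_ge_0 by simp
  have m0: "real m0 \<le> x" "x < real m0 + 1" unfolding m0_def using x0 by linarith+
  obtain m where m: "m \<in> {m0, Suc m0}" "\<not> l dvd m"
    using l by (metis coprime_Suc_right_nat coprime_common_divisor_nat insert_iff not_prime_1)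
  define \<zeta> where "\<zeta> = cis (2 * pi * real m / real L)"
  have "norm (\<zeta> - w) \<le> \<bar>2 * pi * real m / real L - Arg2pi w\<bar>"
    unfolding \<zeta>_def by (subst wc) (rule norm_cis_diff_le)
  also have "2 * pi * real m / real L - Arg2pi w = (2 * pi / real L) * (real m - x)"
    unfolding x_def using L by (simp add: field_simps)
  also have "\<bar>\<dots>\<bar> = (2 * pi / real L) * \<bar>real m - x\<bar>" using L by (simp add: abs_mult)
  also have "\<dots> \<le> (2 * pi / real L) * 1"
    using m(1) m0 by (intro mult_left_mono) auto
  finally have near: "norm (\<zeta> - w) \<le> 2 * pi / real (l ^ j)" by (simp add: L_def)
  have "\<zeta> ^ n = 1 \<longleftrightarrow> l ^ j dvd n" for n
  proof -
    have "\<zeta> ^ n = cis (real n * (2 * pi * real m / real L))"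
      unfolding \<zeta>_def by (rule Complex.DeMoivre)
    also have "real n * (2 * pi * real m / real L) = 2 * pi * real (m * n) / real L" by simp
    also have "cis \<dots> = exp (2 * of_real pi * \<i> * of_nat (m * n) / of_nat L)"
      unfolding cis_conv_exp by (simp add: mult_ac)
    finally have "\<zeta> ^ n = 1 \<longleftrightarrow> L dvd m * n"
      using complex_root_unity_eq_1[of L "m * n"] L by simp
    moreover have "coprime L m" unfolding L_def using m(2) l
      by (simp add: prime_imp_coprime)
    ultimately show ?thesis unfolding L_def by (simp add: coprime_dvd_mult_right_iff)
  qed
  with near show ?thesis using that[of \<zeta>] by (simp add: \<zeta>_def)
qed


section \<open>Truncated absolute values on the natural numbers\<close>

text \<open>At \<open>n = 0\<close> the value is 1, since \<open>multiplicity l 0 = 0\<close>; agreement with the \<open>l\<close>-adic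
  absolute value is for positive \<open>n\<close>.\<close>

definition nat_abs :: "nat \<Rightarrow> nat \<Rightarrow> real" where
  "nat_abs l n = 1 / real l ^ multiplicity l n"

text \<open>This is the maximum of \<open>nat_abs l n\<close> and \<open>1 / l ^ m\<close> for positive \<open>n\<close>; written with a
  gcd it is visibly periodic in \<open>n\<close>, including at \<open>n = 0\<close>.\<close>

definition trunc_abs :: "nat \<Rightarrow> nat \<Rightarrow> nat \<Rightarrow> real" where
  "trunc_abs m l n = 1 / real (gcd n (l ^ m))"

lemma nat_abs_pos: "prime l \<Longrightarrow> 0 < nat_abs l n"
  by (simp add: nat_abs_def prime_gt_0_nat)

lemma nat_abs_le_1: "prime l \<Longrightarrow> nat_abs l n \<le> 1"
  by (auto simp: nat_abs_def divide_le_eq intro!: one_le_power dest: prime_ge_1_nat)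

lemma trunc_abs_pos: "prime l \<Longrightarrow> 0 < trunc_abs m l n"
  by (auto simp: trunc_abs_def prime_gt_0_nat)

lemma trunc_abs_le_1: "prime l \<Longrightarrow> trunc_abs m l n \<le> 1"
proof -
  assume "prime l"
  then have "0 < gcd n (l ^ m)" by (auto simp: prime_gt_0_nat)
  then have "1 \<le> gcd n (l ^ m)" by linarith
  then show ?thesis by (simp add: trunc_abs_def divide_le_eq)
qed

lemma trunc_abs_dvd: "l ^ m dvd n \<Longrightarrow> trunc_abs m l n = 1 / real l ^ m"
  by (simp add: trunc_abs_def gcd_proj2_if_dvd_nat)

lemma trunc_abs_periodic: "l ^ m dvd T \<Longrightarrow> trunc_abs m l (n + T) = trunc_abs m l n"
  unfolding trunc_abs_def by (metis dvdE gcd.commute gcd_add_mult mult.commute add.commute)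

lemma trunc_abs_eq_nat_abs:
  assumes l: "prime l" and n: "\<not> l ^ Suc m dvd n"
  shows "trunc_abs m l n = nat_abs l n"
proof -
  have n0: "n \<noteq> 0" using n by (metis dvd_0_right)
  obtain y where y: "n = l ^ multiplicity l n * y" "\<not> l dvd y"
    using multiplicity_decompose'[of n l] n0 l by (metis not_prime_unit)
  define k where "k = multiplicity l n"
  have k: "k \<le> m"
    using n n0 l unfolding k_def by (metis not_less_eq_eq multiplicity_dvd')
  have "gcd n (l ^ m) = gcd (l ^ k * y) (l ^ k * l ^ (m - k))"
    using y(1) k by (simp add: k_def flip: power_add)
  also have "\<dots> = l ^ k * gcd y (l ^ (m - k))" by (simp add: gcd_mult_distrib_nat)
  also have "coprime y (l ^ (m - k))"
    using y(2) l by (simp add: prime_imp_coprime coprime_commute)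
  then have "gcd y (l ^ (m - k)) = 1" by simp
  finally show ?thesis by (simp add: trunc_abs_def nat_abs_def k_def)
qed

lemma nat_abs_le_of_dvd:
  assumes l: "prime l" and n: "0 < n" "l ^ m dvd n"
  shows "nat_abs l n \<le> 1 / real l ^ m"
proof -
  have "m \<le> multiplicity l n" using n l by (intro multiplicity_geI) auto
  then have "real l ^ m \<le> real l ^ multiplicity l n"
    using prime_ge_1_nat[OF l] by (intro power_increasing) auto
  then show ?thesis using prime_gt_0_nat[OF l] by (simp add: nat_abs_def frac_le)
qed

lemma nat_abs_le_trunc_abs:
  assumes l: "prime l" and n: "0 < n"
  shows "nat_abs l n \<le> trunc_abs m l n"
proof (cases "l ^ m dvd n")
  case True
  then show ?thesis using nat_abs_le_of_dvd[OF l n] by (simp add: trunc_abs_dvd)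
next
  case False
  then have "\<not> l ^ Suc m dvd n" by (meson dvd_trans le_imp_power_dvd lessI less_imp_le)
  then show ?thesis using trunc_abs_eq_nat_abs[OF l] by simp
qed

text \<open>The bound is uniform in \<open>n\<close>, \<open>l\<close> and \<open>e\<close>. The two powers can differ only
  when \<open>e\<close> is positive and \<open>l ^ m\<close> divides \<open>n\<close>, and then both are at most \<open>1 / 2 ^ m\<close>.\<close>

lemma trunc_abs_power_error:
  assumes l: "prime l" and n: "0 < n"
  shows "\<bar>nat_abs l n ^ e - trunc_abs m l n ^ e\<bar> \<le> 1 / 2 ^ m"
proof (cases "e = 0 \<or> \<not> l ^ m dvd n")
  case True
  then show ?thesis
  proof
    assume "\<not> l ^ m dvd n"
    then have "\<not> l ^ Suc m dvd n" by (meson dvd_trans le_imp_power_dvd lessI less_imp_le)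
    then show ?thesis using trunc_abs_eq_nat_abs[OF l] by simp
  qed simp
next
  case False
  have small: "t ^ e \<le> 1 / 2 ^ m" if "0 < t" "t \<le> 1" "t \<le> 1 / real l ^ m" for t :: real
  proof -
    have "t ^ e \<le> t ^ 1" using that False by (intro power_decreasing) auto
    also have "t ^ 1 \<le> 1 / real l ^ m" using that by simp
    also have "\<dots> \<le> 1 / 2 ^ m"
      using prime_ge_2_nat[OF l] by (intro divide_left_mono power_mono) auto
    finally show ?thesis .
  qed
  have "nat_abs l n ^ e \<le> 1 / 2 ^ m"
    using False nat_abs_pos[OF l] nat_abs_le_1[OF l] nat_abs_le_of_dvd[OF l n] by (intro small) auto
  moreover have "trunc_abs m l n ^ e \<le> 1 / 2 ^ m"
    using False by (intro small trunc_abs_pos[OF l] trunc_abs_le_1[OF l]) (simp add: trunc_abs_dvd)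
  moreover have "0 \<le> nat_abs l n ^ e" "0 \<le> trunc_abs m l n ^ e"
    using nat_abs_pos[OF l] trunc_abs_pos[OF l] by (simp_all add: less_imp_le)
  ultimately show ?thesis by linarith
qed

text \<open>The sum is \<open>m\<close> times a number congruent to 1 modulo \<open>l\<close>.\<close>

lemma nat_abs_add_multiple:
  assumes l: "prime l" and m: "0 < m" and T: "l * m dvd T"
  shows "nat_abs l (m + T) = nat_abs l m"
proof -
  obtain k where k: "T = l * m * k" using T by blast
  have "\<not> l dvd 1 + l * k"
    using l by (metis dvd_add_left_iff dvd_triv_left not_prime_unit)
  then have "multiplicity l (1 + l * k) = 0" by (rule not_dvd_imp_multiplicity_0)
  moreover have "m + T = m * (1 + l * k)" by (simp add: k algebra_simps)
  ultimately have "multiplicity l (m + T) = multiplicity l m"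
    using l m prime_elem_multiplicity_mult_distrib[of l m "1 + l * k"] by simp
  then show ?thesis by (simp add: nat_abs_def)
qed

section \<open>Weighted products of absolute values\<close>

text \<open>The sequence \<open>C n * (\<Prod>l\<in>S. |n|_l ^ E l n)\<close> with periodic \<open>C\<close> and \<open>E\<close> is the
  shape that the hypotheses on all primes of \<open>S\<close> give together.\<close>

locale periodic_weights =
  fixes S :: "nat set" and N :: nat and C :: "nat \<Rightarrow> real" and E :: "nat \<Rightarrow> nat \<Rightarrow> nat"
  assumes finite_S: "finite S" and prime_S: "\<And>l. l \<in> S \<Longrightarrow> prime l" and N_pos: "0 < N"
    and C_periodic: "\<And>n. C (n + N) = C n"
    and E_periodic: "\<And>l n. l \<in> S \<Longrightarrow> E l (n + N) = E l n"
    and C_nonneg: "\<And>n. 0 \<le> C n"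
begin

text \<open>The family \<open>x\<close> of absolute values is a parameter, so that exact, truncated and mixed
  families are compared by the same lemmas.\<close>

definition wt :: "(nat \<Rightarrow> nat \<Rightarrow> real) \<Rightarrow> nat \<Rightarrow> real" where
  "wt x n = C n * (\<Prod>l\<in>S. x l n ^ E l n)"

lemma C_shift: "N dvd T \<Longrightarrow> C (n + T) = C n"
proof -
  have "C (n + N * k) = C n" for k
    by (induction k) (simp_all add: C_periodic algebra_simps flip: add.assoc, metis C_periodic add.assoc add.commute)
  then show "N dvd T \<Longrightarrow> C (n + T) = C n" by (auto simp: dvd_def)
qed

lemma E_shift: "l \<in> S \<Longrightarrow> N dvd T \<Longrightarrow> E l (n + T) = E l n"
proof -
  assume l: "l \<in> S"
  have "E l (n + N * k) = E l n" for k
    by (induction k) (simp_all add: E_periodic[OF l] algebra_simps flip: add.assoc, metis E_periodic[OF l] add.assoc add.commute)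
  then show "N dvd T \<Longrightarrow> E l (n + T) = E l n" by (auto simp: dvd_def)
qed

lemma C_bounded: obtains B where "\<And>n. C n \<le> B"
proof
  fix n
  have "C (n mod N + n div N * N) = C (n mod N)" by (rule C_shift) simp
  then have "C n = C (n mod N)" by simp
  also have "\<dots> \<le> (\<Sum>k<N. C k)"
    by (rule member_le_sum) (use N_pos C_nonneg in auto)
  finally show "C n \<le> (\<Sum>k<N. C k)" .
qed

lemma wt_shift:
  assumes "N dvd T" "\<And>l. l \<in> S \<Longrightarrow> x l (n + T) = x l n"
  shows "wt x (n + T) = wt x n"
  unfolding wt_def using assms by (simp add: C_shift E_shift)

lemma wt_nonneg: "(\<And>l. l \<in> S \<Longrightarrow> 0 \<le> x l n) \<Longrightarrow> 0 \<le> wt x n"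
  unfolding wt_def by (intro mult_nonneg_nonneg C_nonneg prod_nonneg) auto

lemma wt_mono:
  "(\<And>l. l \<in> S \<Longrightarrow> 0 \<le> x l n \<and> x l n \<le> y l n) \<Longrightarrow> wt x n \<le> wt y n"
  unfolding wt_def by (intro mult_left_mono C_nonneg prod_mono) (auto intro: power_mono)

lemma wt_le_C: "(\<And>l. l \<in> S \<Longrightarrow> 0 \<le> x l n \<and> x l n \<le> 1) \<Longrightarrow> wt x n \<le> C n"
  using wt_mono[of x n "\<lambda>_ _. 1"] by (simp add: wt_def)

lemma wt_diff_le:
  assumes "\<And>l. l \<in> S \<Longrightarrow> 0 \<le> x l n \<and> x l n \<le> 1" "\<And>l. l \<in> S \<Longrightarrow> 0 \<le> y l n \<and> y l n \<le> 1"
    and "\<And>l. l \<in> S \<Longrightarrow> \<bar>x l n ^ E l n - y l n ^ E l n\<bar> \<le> d"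
  shows "\<bar>wt x n - wt y n\<bar> \<le> C n * (real (card S) * d)"
proof -
  have "\<bar>(\<Prod>l\<in>S. x l n ^ E l n) - (\<Prod>l\<in>S. y l n ^ E l n)\<bar> \<le> (\<Sum>l\<in>S. \<bar>x l n ^ E l n - y l n ^ E l n\<bar>)"
    using norm_prod_diff[of S "\<lambda>l. x l n ^ E l n" "\<lambda>l. y l n ^ E l n"] assms(1,2)
    by (simp add: power_le_one abs_of_nonneg)
  also have "\<dots> \<le> real (card S) * d"
    using sum_bounded_above[of S _ d] assms(3) by simp
  finally have "C n * \<bar>(\<Prod>l\<in>S. x l n ^ E l n) - (\<Prod>l\<in>S. y l n ^ E l n)\<bar> \<le> C n * (real (card S) * d)"
    by (rule mult_left_mono) (rule C_nonneg)
  then show ?thesis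
    unfolding wt_def using C_nonneg by (simp add: abs_mult flip: right_diff_distrib)
qed

lemma wt_split:
  "l \<in> S \<Longrightarrow> wt x n = C n * (\<Prod>l'\<in>S - {l}. x l' n ^ E l' n) * x l n ^ E l n"
  unfolding wt_def by (simp add: prod.remove[OF finite_S] mult_ac)

text \<open>With the \<open>l\<close>-part cut off at \<open>l ^ (j - 1)\<close>, truncating the remaining primes at a high
  power \<open>M\<close> gives an approximation whose period \<open>T\<close> contains \<open>l\<close> exactly \<open>j - 1\<close> times,
  whatever \<open>M\<close> is. So a root of unity of order \<open>l ^ j\<close> is never a \<open>T\<close>-th root of unity.\<close>

lemma one_prime_truncated_limit_periodic:
  assumes l: "l \<in> S" and j: "N < j" and B: "\<And>n. C n \<le> B"
    and order: "\<And>n. \<zeta> ^ n = 1 \<longleftrightarrow> l ^ j dvd n" and \<epsilon>: "0 < \<epsilon>"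
  defines "x \<equiv> \<lambda>l'. if l' = l then trunc_abs (j - 1) l else nat_abs l'"
  shows "\<exists>q T. (\<forall>n>0. norm (q n) \<le> B) \<and> (\<forall>n. q (n + T) = q n) \<and>
      (\<zeta>::complex) ^ T \<noteq> 1 \<and> (\<forall>n>0. norm (complex_of_real (wt x n) - q n) \<le> \<epsilon>)"
proof -
  have pl: "prime l" using prime_S l by blast
  have B0: "0 \<le> B" using B[of 0] C_nonneg[of 0] by linarith
  obtain N' where N': "N = l ^ multiplicity l N * N'" "\<not> l dvd N'"
    using multiplicity_decompose'[of N l] N_pos pl by (metis not_prime_unit less_irrefl)
  \<comment> \<open>The power of \<open>l\<close> in \<open>N\<close> must fit into \<open>l ^ (j - 1)\<close> for \<open>T\<close> to be a multiple of \<open>N\<close>.\<close>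
  have "2 ^ multiplicity l N \<le> l ^ multiplicity l N"
    using prime_ge_2_nat[OF pl] by (intro power_mono) auto
  also have "\<dots> \<le> N" using N_pos by (intro dvd_imp_le multiplicity_dvd)
  finally have "multiplicity l N < N" using less_exp[of "multiplicity l N"] by linarith
  then have v: "multiplicity l N \<le> j - 1" using j by linarith
  have "(\<lambda>M. B * (real (card S) * (1 / 2 ^ M))) \<longlonglongrightarrow> B * (real (card S) * 0)"
    by (intro tendsto_intros) (simp add: LIMSEQ_inverse_realpow_zero divide_inverse)
  then have "\<forall>\<^sub>F M in sequentially. B * (real (card S) * (1 / 2 ^ M)) < \<epsilon>"
    using \<epsilon> by (intro order_tendstoD(2)) auto
  then obtain M :: nat where M: "B * (real (card S) * (1 / 2 ^ M)) < \<epsilon>"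
    by (auto simp: eventually_sequentially)
  define y where "y = (\<lambda>l'. trunc_abs (if l' = l then j - 1 else M) l')"
  define R where "R = N' * (\<Prod>l'\<in>S - {l}. l' ^ M)"
  define T where "T = R * l ^ (j - 1)"
  have dvd: "l' ^ (if l' = l then j - 1 else M) dvd T" if "l' \<in> S" for l'
  proof (cases "l' = l")
    case False
    then have "l' ^ M dvd (\<Prod>l'\<in>S - {l}. l' ^ M)" using that finite_S by (intro dvd_prodI) auto
    then show ?thesis using False by (simp add: T_def R_def dvd_mult dvd_mult2)
  qed (simp add: T_def)
  have "l ^ multiplicity l N * N' dvd l ^ (j - 1) * N'"
    using v by (intro mult_dvd_mono le_imp_power_dvd) auto
  then have "N dvd l ^ (j - 1) * N'" using N'(1) by simp
  then have NT: "N dvd T"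
    unfolding T_def R_def by (metis dvd_mult2 mult.assoc mult.commute)
  have "\<not> l dvd R"
  proof
    assume "l dvd R"
    then obtain l' where l': "l' \<in> S - {l}" "l dvd l' ^ M"
      using N'(2) pl finite_S by (auto simp: R_def prime_dvd_mult_iff prime_dvd_prod_iff)
    then have "l dvd l'" using pl prime_dvd_power by blast
    then show False using l' pl prime_S primes_dvd_imp_eq[of l l'] by blast
  qed
  moreover have "l ^ j = l ^ (j - 1) * l" using j by (simp flip: power_Suc2)
  ultimately have "\<not> l ^ j dvd T" using pl by (simp add: T_def mult.commute[of R])
  then have T: "\<zeta> ^ T \<noteq> 1" using order by simp
  have y: "0 \<le> y l' n \<and> y l' n \<le> 1" if "l' \<in> S" for l' n
    unfolding y_def using prime_S[OF that] trunc_abs_pos trunc_abs_le_1 by (simp add: less_imp_le)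
  have x: "0 \<le> x l' n \<and> x l' n \<le> 1" if "l' \<in> S" for l' n
    unfolding x_def using prime_S[OF that] trunc_abs_pos trunc_abs_le_1 nat_abs_pos nat_abs_le_1
    by (auto simp: less_imp_le)
  have "norm (complex_of_real (wt y n)) \<le> B" for n
    using wt_nonneg[of y n] wt_le_C[of y n] y B[of n] by simp
  moreover have "complex_of_real (wt y (n + T)) = of_real (wt y n)" for n
    using wt_shift[OF NT, of y n] dvd by (simp add: y_def trunc_abs_periodic)
  moreover have "norm (complex_of_real (wt x n) - of_real (wt y n)) \<le> \<epsilon>" if "0 < n" for n
  proof -
    have "\<bar>wt x n - wt y n\<bar> \<le> C n * (real (card S) * (1 / 2 ^ M))"
      using trunc_abs_power_error[OF prime_S that]
      by (intro wt_diff_le x y) (auto simp: x_def y_def)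
    also have "\<dots> \<le> B * (real (card S) * (1 / 2 ^ M))"
      using B by (intro mult_right_mono) auto
    finally have "\<bar>wt x n - wt y n\<bar> \<le> \<epsilon>" using M by linarith
    then show ?thesis by (simp flip: of_real_diff)
  qed
  ultimately show ?thesis using T
    by (intro exI[of _ "\<lambda>n. complex_of_real (wt y n)"] exI[of _ T]) blast
qed

text \<open>The cut-off changes the sequence only at multiples of \<open>l ^ j\<close>, where \<open>\<zeta> ^ n = 1\<close>, and it
  can only increase the values. The series of the differences \<open>h\<close> therefore has no cancellation
  at \<open>\<zeta>\<close>, whereas the cut-off series grows more slowly than \<open>1 / (1 - r)\<close> there.\<close>

lemma radial_growth:
  fixes \<zeta> :: complex
  assumes l: "l \<in> S" and j: "N < j" and \<zeta>: "norm \<zeta> = 1"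
    and order: "\<And>n. \<zeta> ^ n = 1 \<longleftrightarrow> l ^ j dvd n"
    and m: "0 < m" "l ^ j dvd m" "0 < E l m" "0 < C m"
  shows "\<not> ((\<lambda>r. of_real (1 - r) * gen_series (\<lambda>n. of_real (wt nat_abs n)) (of_real r * \<zeta>)) \<longlongrightarrow> 0) (at_left 1)"
proof
  let ?D = "\<lambda>u r. of_real (1 - r) * gen_series (\<lambda>n. complex_of_real (u n)) (of_real r * \<zeta>)"
  assume lim: "(?D (wt nat_abs) \<longlongrightarrow> 0) (at_left 1)"
  have pl: "prime l" using prime_S l by blast
  obtain B where B: "\<And>n. C n \<le> B" using C_bounded by blast
  define x where "x = (\<lambda>l'. if l' = l then trunc_abs (j - 1) l else nat_abs l')"
  define h where "h = (\<lambda>n. wt x n - wt nat_abs n)"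
  have x: "0 \<le> x l' n \<and> x l' n \<le> 1" if "l' \<in> S" for l' n
    unfolding x_def using prime_S[OF that] trunc_abs_pos trunc_abs_le_1 nat_abs_pos nat_abs_le_1
    by (auto simp: less_imp_le)
  have a: "0 \<le> nat_abs l' n \<and> nat_abs l' n \<le> 1" if "l' \<in> S" for l' n
    using prime_S[OF that] nat_abs_pos nat_abs_le_1 by (auto simp: less_imp_le)
  have wx: "0 \<le> wt x n \<and> wt x n \<le> B" for n
    using wt_nonneg[of x n] wt_le_C[of x n] x B[of n] by force
  have wa: "0 \<le> wt nat_abs n \<and> wt nat_abs n \<le> B" for n
    using wt_nonneg[of nat_abs n] wt_le_C[of nat_abs n] a B[of n] by force
  have h0: "0 \<le> h n" if "0 < n" for n
    unfolding h_def using a nat_abs_le_trunc_abs[OF pl that] by (auto intro!: wt_mono simp: x_def)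
  have hB: "h n \<le> B" for n using wx[of n] wa[of n] unfolding h_def by linarith
  have hz: "\<zeta> ^ n = 1" if "h n \<noteq> 0" for n
  proof (rule ccontr)
    assume "\<zeta> ^ n \<noteq> 1"
    then have "\<not> l ^ Suc (j - 1) dvd n" using order j by simp
    then have "x l' n = nat_abs l' n" for l' using trunc_abs_eq_nat_abs[OF pl] by (simp add: x_def)
    then show False using that by (simp add: h_def wt_def)
  qed
  have "(?D (wt x) \<longlongrightarrow> 0) (at_left 1)"
  proof (rule radial_limit_limit_periodic[OF _ \<zeta>])
    show "norm (complex_of_real (wt x n)) \<le> B" for n using wx[of n] by simp
    show "\<exists>q T. (\<forall>n>0. norm (q n) \<le> B) \<and> (\<forall>n. q (n + T) = q n) \<and>
      \<zeta> ^ T \<noteq> 1 \<and> (\<forall>n>0. norm (complex_of_real (wt x n) - q n) \<le> \<epsilon>)" if "0 < \<epsilon>" for \<epsilon>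
      unfolding x_def by (rule one_prime_truncated_limit_periodic[OF l j B order that])
  qed
  from tendsto_diff[OF this lim] have "((\<lambda>r. ?D (wt x) r - ?D (wt nat_abs) r) \<longlongrightarrow> 0) (at_left 1)"
    by simp
  moreover have "eventually (\<lambda>r. ?D (wt x) r - ?D (wt nat_abs) r = ?D h r) (at_left 1)"
    using at_left_1_less
  proof eventually_elim
    case (elim r)
    have "gen_series (\<lambda>n. complex_of_real (h n) + complex_of_real (wt nat_abs n)) (of_real r * \<zeta>)
        = gen_series (\<lambda>n. of_real (h n)) (of_real r * \<zeta>) + gen_series (\<lambda>n. of_real (wt nat_abs n)) (of_real r * \<zeta>)"
      by (rule gen_series_add[where B = B and B' = B])
        (use h0 hB wa elim \<zeta> in \<open>auto simp: norm_mult\<close>)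
    then show ?case by (simp add: h_def flip: right_diff_distrib)
  qed
  ultimately have "(?D h \<longlongrightarrow> 0) (at_left 1)" using tendsto_cong by (rule_tac iffD1)
  moreover have "\<not> (?D h \<longlongrightarrow> 0) (at_left 1)"
  \<comment> \<open>A step of \<open>N * m * \<Prod>S\<close> from \<open>m\<close> preserves \<open>C\<close>, \<open>E\<close> and, by the factor \<open>m * l'\<close>,
    every absolute value, so \<open>h\<close> is constant along this progression.\<close>
  proof (rule radial_lower_bound[where m = m and Q = "N * m * \<Prod>S" and c = "h m", OF h0 hB hz _ _ m(1) _ \<zeta>])
    have "0 < \<Prod>S" using prime_S prime_gt_0_nat by (intro prod_pos) auto
    then show "0 < N * m * \<Prod>S" using N_pos m(1) by simp
    show "h (m + t * (N * m * \<Prod>S)) = h m" for t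
    proof -
      let ?T = "t * (N * m * \<Prod>S)"
      have na: "nat_abs l' (m + ?T) = nat_abs l' m" if "l' \<in> S" for l'
      proof (rule nat_abs_add_multiple[OF prime_S[OF that] m(1)])
        have "l' dvd \<Prod>S" using dvd_prodI[OF finite_S that, of "\<lambda>l. l"] by simp
        then have "m * l' dvd m * \<Prod>S" by simp
        then show "l' * m dvd ?T" by (metis dvd_mult mult.assoc mult.commute)
      qed
      have "l ^ (j - 1) dvd m" using m(2) le_imp_power_dvd[of "j - 1" j l] by (meson diff_le_self dvd_trans)
      then have "l ^ (j - 1) dvd ?T" by simp
      then have "x l' (m + ?T) = x l' m" if "l' \<in> S" for l'
        unfolding x_def using na[OF that] by (simp add: trunc_abs_periodic)
      moreover have "N dvd ?T" by simp
      ultimately show ?thesis unfolding h_def using wt_shift na by simp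
    qed
    have "l ^ (j - 1) dvd m" using m(2) le_imp_power_dvd[of "j - 1" j l] by (meson diff_le_self dvd_trans)
    then have xl: "x l m = 1 / real l ^ (j - 1)" by (simp add: x_def trunc_abs_dvd)
    have "nat_abs l m \<le> 1 / real l ^ j" by (rule nat_abs_le_of_dvd[OF pl m(1,2)])
    also have "\<dots> < 1 / real l ^ (j - 1)"
      using prime_gt_1_nat[OF pl] j by (intro divide_strict_left_mono power_strict_increasing) auto
    finally have "nat_abs l m ^ E l m < x l m ^ E l m"
      unfolding xl using m(3) nat_abs_pos[OF pl] by (intro power_strict_mono) (auto simp: less_imp_le)
    moreover have "0 < C m * (\<Prod>l'\<in>S - {l}. nat_abs l' m ^ E l' m)"
      using m(4) prime_S nat_abs_pos by (intro mult_pos_pos prod_pos) auto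
    moreover have "(\<Prod>l'\<in>S - {l}. x l' m ^ E l' m) = (\<Prod>l'\<in>S - {l}. nat_abs l' m ^ E l' m)"
      by (intro prod.cong) (auto simp: x_def)
    ultimately show "0 < h m"
      unfolding h_def wt_split[OF l] by (simp only: mult_strict_left_mono diff_gt_0_iff_gt)
  qed
  ultimately show False by contradiction
qed

text \<open>The prime is allowed to vary with \<open>j\<close>: the argument for a given arc of the circle uses one
  sufficiently large \<open>j\<close> only.\<close>

definition unbounded_valuation :: bool where
  "unbounded_valuation \<longleftrightarrow> (\<forall>j. \<exists>l\<in>S. \<exists>n>0. l ^ j dvd n \<and> 0 < E l n \<and> 0 < C n)"

lemma wt_nat_abs_bounded: obtains B where "\<And>n. norm (complex_of_real (wt nat_abs n)) \<le> B"
proof -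
  obtain B where B: "\<And>n. C n \<le> B" using C_bounded by blast
  have "norm (complex_of_real (wt nat_abs n)) \<le> B" for n
    using wt_nonneg[of nat_abs n] wt_le_C[of nat_abs n] prime_S nat_abs_pos nat_abs_le_1 B[of n]
    by (force simp: less_imp_le)
  then show ?thesis using that by blast
qed

text \<open>Roots of unity of order \<open>l ^ j\<close> are \<open>2 * pi / 2 ^ j\<close>-dense for every prime \<open>l\<close>, so each
  arc contains one at which the series grows like \<open>1 / (1 - r)\<close>.\<close>

lemma natural_boundary:
  assumes unbounded_valuation
  shows "unit_circle_natural_boundary (gen_series (\<lambda>n. of_real (wt nat_abs n)))"
  unfolding unit_circle_natural_boundary_def
proof (intro conjI ballI notI)
  obtain B where B: "\<And>n. norm (complex_of_real (wt nat_abs n)) \<le> B" using wt_nat_abs_bounded by blast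
  show "gen_series (\<lambda>n. complex_of_real (wt nat_abs n)) analytic_on ball 0 1"
    by (rule gen_series_analytic) (rule B)
  fix w :: complex
  assume "w \<in> sphere 0 1" and "\<exists>U g. open U \<and> w \<in> U \<and> g analytic_on U \<and>
     (\<forall>z\<in>U \<inter> ball 0 1. g z = gen_series (\<lambda>n. complex_of_real (wt nat_abs n)) z)"
  then obtain U g where w: "norm w = 1" and U: "open U" "w \<in> U" and g: "g analytic_on U"
    and eq: "\<And>z. z \<in> U \<inter> ball 0 1 \<Longrightarrow> g z = gen_series (\<lambda>n. complex_of_real (wt nat_abs n)) z"
    by auto
  obtain d where d: "0 < d" "ball w d \<subseteq> U" using U open_contains_ball by blast
  have "(\<lambda>j. 2 * pi * (1 / 2 ^ j)) \<longlonglongrightarrow> 2 * pi * 0"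
    by (intro tendsto_intros) (simp add: LIMSEQ_inverse_realpow_zero divide_inverse)
  then have "\<forall>\<^sub>F j in sequentially. 2 * pi * (1 / 2 ^ j) < d"
    using d by (intro order_tendstoD(2)) auto
  then have "\<forall>\<^sub>F j in sequentially. 2 * pi * (1 / 2 ^ j) < d \<and> N < j"
    using eventually_gt_at_top by (rule eventually_conj)
  then obtain j where j: "2 * pi * (1 / 2 ^ j) < d" "N < j"
    by (auto simp: eventually_sequentially)
  obtain l m where l: "l \<in> S" and m: "0 < m" "l ^ j dvd m" "0 < E l m" "0 < C m"
    using assms unfolding unbounded_valuation_def by blast
  have pl: "prime l" using prime_S l by blast
  obtain \<zeta> where \<zeta>: "norm \<zeta> = 1" "norm (\<zeta> - w) \<le> 2 * pi / real (l ^ j)" "\<And>n. \<zeta> ^ n = 1 \<longleftrightarrow> l ^ j dvd n"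
    using primitive_prime_power_root_near[OF w pl] by metis
  have "2 * pi / real (l ^ j) \<le> 2 * pi / 2 ^ j"
    using prime_ge_2_nat[OF pl] by (intro divide_left_mono) (auto intro: power_mono)
  then have "\<zeta> \<in> ball w d" using \<zeta>(2) j(1) by (simp add: dist_norm norm_minus_commute)
  then have "\<zeta> \<in> U" using d by blast
  from radial_limit_regular_point[OF U(1) this g eq \<zeta>(1)] radial_growth[OF l j(2) \<zeta>(1,3) m]
  show False by simp
qed

text \<open>If no relevant index is divisible by \<open>l ^ j\<close>, truncation at \<open>l ^ j\<close> loses nothing.\<close>

lemma periodic_values:
  assumes "\<not> unbounded_valuation"
  obtains q T where "0 < T" "\<And>n. q (n + T) = q n" "\<And>n. 0 < n \<Longrightarrow> wt nat_abs n = q n"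
proof -
  obtain j where j: "\<And>l n. l \<in> S \<Longrightarrow> 0 < n \<Longrightarrow> l ^ j dvd n \<Longrightarrow> 0 < C n \<Longrightarrow> E l n = 0"
    using assms unfolding unbounded_valuation_def by blast
  define T where "T = N * (\<Prod>l\<in>S. l ^ j)"
  have "0 < (\<Prod>l\<in>S. l ^ j)" using prime_S prime_gt_0_nat by (intro prod_pos) auto
  then have "0 < T" using N_pos by (simp add: T_def)
  moreover have "wt (trunc_abs j) (n + T) = wt (trunc_abs j) n" for n
  proof (rule wt_shift)
    fix l assume "l \<in> S"
    then have "l ^ j dvd (\<Prod>l\<in>S. l ^ j)" using finite_S by (intro dvd_prodI)
    then show "trunc_abs j l (n + T) = trunc_abs j l n" by (intro trunc_abs_periodic) (simp add: T_def)
  qed (simp add: T_def)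
  moreover have "wt nat_abs n = wt (trunc_abs j) n" if "0 < n" for n
  proof (cases "C n = 0")
    case False
    then have "0 < C n" using C_nonneg[of n] by simp
    have "nat_abs l n ^ E l n = trunc_abs j l n ^ E l n" if l: "l \<in> S" for l
    proof (cases "l ^ j dvd n")
      case True
      then show ?thesis using j[OF l \<open>0 < n\<close> True \<open>0 < C n\<close>] by simp
    next
      case False
      then have "\<not> l ^ Suc j dvd n" by (meson dvd_trans le_imp_power_dvd lessI less_imp_le)
      then show ?thesis using trunc_abs_eq_nat_abs prime_S[OF l] by simp
    qed
    then show ?thesis unfolding wt_def by simp
  qed (simp add: wt_def)
  ultimately show ?thesis using that by blast
qed

lemma rational:
  assumes "\<not> unbounded_valuation"
  shows "rational_on_unit_disc (gen_series (\<lambda>n. of_real (wt nat_abs n)))"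
proof -
  obtain q T where q: "0 < T" "\<And>n. q (n + T) = q n" "\<And>n. 0 < n \<Longrightarrow> wt nat_abs n = q n"
    using periodic_values[OF assms] by metis
  obtain B where B: "\<And>n. norm (complex_of_real (wt nat_abs n)) \<le> B" using wt_nat_abs_bounded by blast
  have "rational_on_unit_disc (gen_series (\<lambda>n. complex_of_real (q n)))"
  proof (rule gen_series_periodic_rational[OF _ _ q(1)])
    show "norm (complex_of_real (q n)) \<le> B" if "0 < n" for n using B[of n] q(3)[OF that] by simp
  qed (simp only: q(2))
  moreover have "gen_series (\<lambda>n. complex_of_real (q n)) = gen_series (\<lambda>n. of_real (wt nat_abs n))"
    by (simp add: gen_series_def q(3) fun_eq_iff)
  ultimately show ?thesis by simp
qed

text \<open>High divisibility at an index with positive exponent produces positive values of size at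
  most \<open>B / 2 ^ j\<close>, hence infinitely many values; otherwise the values are periodic.\<close>

lemma finite_values_iff: "finite (wt nat_abs ` {1..}) \<longleftrightarrow> \<not> unbounded_valuation"
proof
  assume "\<not> unbounded_valuation"
  then obtain q T where q: "0 < T" "\<And>n. q (n + T) = q n" "\<And>n. 0 < n \<Longrightarrow> wt nat_abs n = q n"
    using periodic_values by metis
  have qk: "q (n + k * T) = q n" for n k
  proof (induction k)
    case (Suc k)
    then show ?case using q(2)[of "n + k * T"] by (simp add: add_ac)
  qed simp
  have "q n = q (n mod T)" for n using qk[of "n mod T" "n div T"] by simp
  then have "wt nat_abs ` {1..} \<subseteq> q ` {..<T}" using q(1,3) by (force simp: image_iff)
  then show "finite (wt nat_abs ` {1..})" by (rule finite_subset) simp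
next
  assume fin: "finite (wt nat_abs ` {1..})"
  show "\<not> unbounded_valuation"
  proof
    assume unb: unbounded_valuation
    obtain B where B: "\<And>n. C n \<le> B" using C_bounded by blast
    define V where "V = insert 1 (wt nat_abs ` {1..} \<inter> {0<..})"
    have V: "finite V" "V \<noteq> {}" using fin by (auto simp: V_def)
    have d: "0 < Min V" using V by (simp add: V_def)
    have "(\<lambda>j. B * (1 / 2 ^ j)) \<longlonglongrightarrow> B * 0"
      by (intro tendsto_intros) (simp add: LIMSEQ_inverse_realpow_zero divide_inverse)
    then have "\<forall>\<^sub>F j in sequentially. B * (1 / 2 ^ j) < Min V"
      using d by (intro order_tendstoD(2)) auto
    then obtain j :: nat where j: "B * (1 / 2 ^ j) < Min V" by (auto simp: eventually_sequentially)
    obtain l n where l: "l \<in> S" and n: "0 < n" "l ^ j dvd n" "0 < E l n" "0 < C n"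
      using unb unfolding unbounded_valuation_def by blast
    have pl: "prime l" using prime_S l by blast
    have pos: "0 < wt nat_abs n"
      unfolding wt_def using n prime_S nat_abs_pos by (intro mult_pos_pos prod_pos) auto
    have "(\<Prod>l'\<in>S - {l}. nat_abs l' n ^ E l' n) \<le> 1"
      using prime_S nat_abs_pos nat_abs_le_1 by (intro prod_le_1) (auto simp: less_imp_le power_le_one)
    then have "C n * (\<Prod>l'\<in>S - {l}. nat_abs l' n ^ E l' n) \<le> B"
      using B[of n] n(4) by (smt (verit) mult_left_le)
    moreover have "nat_abs l n ^ E l n \<le> 1 / 2 ^ j"
    proof -
      have "nat_abs l n ^ E l n \<le> nat_abs l n ^ 1"
        using n(3) nat_abs_pos[OF pl] nat_abs_le_1[OF pl] by (intro power_decreasing) (auto simp: less_imp_le)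
      also have "\<dots> \<le> 1 / real l ^ j" using nat_abs_le_of_dvd[OF pl n(1,2)] by simp
      also have "\<dots> \<le> 1 / 2 ^ j"
        using prime_ge_2_nat[OF pl] by (intro divide_left_mono) (auto intro: power_mono)
      finally show ?thesis .
    qed
    ultimately have "wt nat_abs n \<le> B * (1 / 2 ^ j)"
      unfolding wt_split[OF l] using B[of n] n(4) nat_abs_pos[OF pl]
      by (intro mult_mono) (auto simp: less_imp_le)
    moreover have "Min V \<le> wt nat_abs n"
      using V pos n(1) by (intro Min_le) (auto simp: V_def)
    ultimately show False using j by linarith
  qed
qed

end

section \<open>The dichotomy\<close>

lemma of_rat_ladic_abs_of_nat:
  assumes "prime l" "0 < n"
  shows "(of_rat (ladic_abs l (of_nat n)) :: real) = nat_abs l n"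
proof -
  have q: "quotient_of (of_nat n) = (int n, 1)"
    using quotient_of_int[of "int n"] by (simp add: Rat.of_int_def)
  have "multiplicity (int l) (int n) = multiplicity l n"
    unfolding multiplicity_def by (simp flip: of_nat_power)
  then show ?thesis using assms
    by (simp add: ladic_abs_def q nat_abs_def power_int_minus of_rat_inverse of_rat_power divide_inverse)
qed

lemma of_real_of_rat: "of_real (of_rat x) = (of_rat x :: 'a :: real_field)"
proof -
  obtain p q where "quotient_of x = (p, q)" by (metis surj_pair)
  then have "x = of_int p / of_int q" by (rule quotient_of_div)
  then show ?thesis by (simp add: of_rat_divide)
qed

lemma ladic_abs_nonneg: "0 \<le> ladic_abs l x"
  by (simp add: ladic_abs_def)

theorem theoremA1:
  fixes a :: "nat \<Rightarrow> int" and S :: "nat set"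
  assumes a: "\<And>l :: nat. prime l \<Longrightarrow>
      \<exists>N > 0. \<exists>(c :: nat \<Rightarrow> rat) (e :: nat \<Rightarrow> nat).
        \<forall>k < N. \<forall>n \<ge> 1. [n = k] (mod N) \<longrightarrow>
          ladic_abs l (of_int (a n)) = c k * ladic_abs l (of_nat n) ^ e k"
    and S: "finite S" "\<And>l. l \<in> S \<Longrightarrow> prime l"
  shows "(infinite ((\<lambda>n. S_abs S (of_int (a n))) ` {1..}) \<longrightarrow>
            unit_circle_natural_boundary (S_abs_series S a)) \<and>
         (finite ((\<lambda>n. S_abs S (of_int (a n))) ` {1..}) \<longrightarrow>
            rational_on_unit_disc (S_abs_series S a))"
proof -
  have "\<forall>l\<in>S. \<exists>N c e. 0 < N \<and> (\<forall>n\<ge>1. ladic_abs l (of_int (a n)) =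
      c (n mod N) * ladic_abs l (of_nat n) ^ e (n mod N))"
  proof
    fix l assume "l \<in> S"
    from a[OF S(2)[OF this]] obtain N c e where "0 < N" and
      *: "\<And>k n. k < N \<Longrightarrow> n \<ge> 1 \<Longrightarrow> [n = k] (mod N) \<Longrightarrow>
          ladic_abs l (of_int (a n)) = c k * ladic_abs l (of_nat n) ^ e k" by blast
    have "ladic_abs l (of_int (a n)) = c (n mod N) * ladic_abs l (of_nat n) ^ e (n mod N)" if "n \<ge> 1" for n
      using *[of "n mod N" n] that \<open>0 < N\<close> by (simp add: cong_def)
    with \<open>0 < N\<close> show "\<exists>N c e. 0 < N \<and> (\<forall>n\<ge>1. ladic_abs l (of_int (a n)) =
      c (n mod N) * ladic_abs l (of_nat n) ^ e (n mod N))" by blast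
  qed
  then obtain M c e where M: "\<And>l. l \<in> S \<Longrightarrow> 0 < M l" and
    ce: "\<And>l n. l \<in> S \<Longrightarrow> n \<ge> 1 \<Longrightarrow> ladic_abs l (of_int (a n)) =
      c l (n mod M l) * ladic_abs l (of_nat n) ^ e l (n mod M l)"
    by metis
  \<comment> \<open>A common multiple of the moduli serves all primes of \<open>S\<close> at once.\<close>
  define N where "N = \<Prod>(M ` S)"
  have N: "0 < N" unfolding N_def using M by (intro prod_pos) auto
  have dvd: "M l dvd N" if "l \<in> S" for l
    unfolding N_def using dvd_prodI[of "M ` S" "M l" "\<lambda>x. x"] S(1) that by simp
  have md: "(n + N) mod M l = n mod M l" if "l \<in> S" for l n
    using dvd[OF that] by (auto simp: dvd_def)
  define C :: "nat \<Rightarrow> real" where "C = (\<lambda>n. \<Prod>l\<in>S. of_rat (c l (n mod M l)))"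
  define E where "E = (\<lambda>l n. e l (n mod M l))"
  \<comment> \<open>Every residue class contains a positive index, here \<open>n + N\<close>, which fixes the sign of its constant.\<close>
  have c0: "0 \<le> c l (n mod M l)" if l: "l \<in> S" for l n
  proof -
    have "0 \<le> ladic_abs l (of_int (a (n + N)))" by (rule ladic_abs_nonneg)
    also have "\<dots> = c l (n mod M l) * ladic_abs l (of_nat (n + N)) ^ e l (n mod M l)"
      using ce[OF l, of "n + N"] N md[OF l] by simp
    finally have *: "0 \<le> c l (n mod M l) * ladic_abs l (of_nat (n + N)) ^ e l (n mod M l)" .
    have "0 < (of_rat (ladic_abs l (of_nat (n + N))) :: real)"
      using of_rat_ladic_abs_of_nat[OF S(2)[OF l], of "n + N"] N nat_abs_pos[OF S(2)[OF l]] by simp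
    then have "0 < ladic_abs l (of_nat (n + N)) ^ e l (n mod M l)" by simp
    with * show ?thesis by (simp add: zero_le_mult_iff)
  qed
  interpret periodic_weights S N C E
    by unfold_locales (use S N md c0 in \<open>auto simp: C_def E_def intro!: prod_nonneg\<close>)
  have wt_eq: "wt x n = (\<Prod>l\<in>S. of_rat (c l (n mod M l))) * (\<Prod>l\<in>S. x l n ^ e l (n mod M l))" for x n
    unfolding wt_def by (simp add: C_def E_def)
  have val: "(of_rat (S_abs S (of_int (a n))) :: real) = wt nat_abs n" if "0 < n" for n
    using that S(2)
    by (simp add: S_abs_def ce of_rat_prod of_rat_mult of_rat_power of_rat_ladic_abs_of_nat
        wt_eq prod.distrib)
  have "S_abs_series S a = gen_series (\<lambda>n. of_real (wt nat_abs n))"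
    unfolding S_abs_series_def gen_series_def by (simp add: of_real_of_rat flip: val)
  moreover have "finite (wt nat_abs ` {1..}) \<longleftrightarrow> finite ((\<lambda>n. S_abs S (of_int (a n))) ` {1..})"
  proof -
    have "wt nat_abs ` {1..} = of_rat ` ((\<lambda>n. S_abs S (of_int (a n))) ` {1..})"
      by (auto simp: image_image val)
    then show ?thesis using finite_image_iff[of "of_rat :: rat \<Rightarrow> real"] by (simp add: inj_on_def)
  qed
  ultimately show ?thesis
    using natural_boundary rational finite_values_iff by metis
qed

end
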